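(* Let $p$ be an odd prime, let $k,n$ be integers with $1\leq k<n$ and $n\geq 3$, and let $F:\mathbb{F}_{p^n}\to\mathbb{F}_{p^n}$, $F(x)=x^{\frac{p^k+1}{2}}$. Then, for $c=-1$, $F$ is PcN (that is, ${}_{-1}\Delta_F=1$) if and only if $\frac{2n}{\gcd(2n,k)}$ is odd. Otherwise (that is, if $\frac{2n}{\gcd(2n,k)}$ is even), the $(-1)$-differential uniformity of $F$ is ${}_{-1}\Delta_F=\frac{p^{\gcd(k,n)}+1}{2}$.
   Context: Let $p$ be a prime, $n$ a positive integer, and $\mathbb{F}_{p^n}$ the finite field with $p^n$ elements. For a function $F:\mathbb{F}_{p^n}\to\mathbb{F}_{p^n}$ and $a,b,c\in\mathbb{F}_{p^n}$, let ${}_c\Delta_F(a,b)=|\{x\in\mathbb{F}_{p^n} : F(x+a)-cF(x)=b\}|$. The $c$-differential uniformity of $F$ is ${}_c\Delta_F=\max\{{}_c\Delta_F(a,b) : a,b\in\mathbb{F}_{p^n},\ \text{and } a\neq 0 \text{ if } c=1\}$ (so for $c\neq 1$ the value $a=0$ is allowed). $F$ is called perfect $c$-nonlinear (PcN) if ${}_c\Delta_F=1$. *)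

theory Defs
  imports "HOL-Computational_Algebra.Primes"
begin

definition c_diff_count :: "('a::{field,finite} \<Rightarrow> 'a) \<Rightarrow> 'a \<Rightarrow> 'a \<Rightarrow> 'a \<Rightarrow> nat" where
  "c_diff_count F c a b = card {x. F (x + a) - c * F x = b}"

definition c_diff_uniformity :: "('a::{field,finite} \<Rightarrow> 'a) \<Rightarrow> 'a \<Rightarrow> nat" where
  "c_diff_uniformity F c = Max {c_diff_count F c a b | a b. c = 1 \<longrightarrow> a \<noteq> 0}"

definition perfect_c_nonlinear :: "('a::{field,finite} \<Rightarrow> 'a) \<Rightarrow> 'a \<Rightarrow> bool" where
  "perfect_c_nonlinear F c \<longleftrightarrow> c_diff_uniformity F c = 1"

end

theory Submission
  imports Defs "HOL-Library.Cardinality" "HOL-Algebra.Algebraic_Closure_Type" "HOL-Number_Theory.Pocklington"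
begin

text \<open>
  Put \<open>q = p ^ n\<close> and \<open>d = (p ^ k + 1) div 2\<close>. In the algebraic closure, the substitution
  \<open>x = (v + 1/v - 2) / 4\<close> turns \<open>2 * ((x + 1) ^ d + x ^ d)\<close> into \<open>v ^ d + 1 / v ^ d\<close>: with \<open>z\<^sup>2 = v\<close>,
  both \<open>x + 1\<close> and \<open>x\<close> are squares, namely of \<open>(z + 1/z) / 2\<close> and \<open>(z - 1/z) / 2\<close>, and the
  Frobenius map is additive. The values \<open>v + 1/v\<close> lying in the ground field are those with
  \<open>v ^ (q - 1) = 1\<close> or \<open>v ^ (q + 1) = 1\<close>, so for \<open>a \<noteq> 0\<close> one counts fibres of a Dickson polynomial.
  No fibre has more than \<open>max (gcd d (q - 1)) (gcd d (q + 1))\<close> elements; the first number is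
  attained for \<open>a = 0\<close>, the second for \<open>a = 1\<close>, and both gcds are computed by elementary means.
\<close>

hide_const (open) Divisibility.prime

section \<open>Greatest common divisors of shifted powers\<close>

text \<open>The cofactor is the alternating sum \<open>P ^ (j - 1) - P ^ (j - 2) + ... + 1\<close>:
  it has \<open>j\<close> odd terms, hence is odd. The induction runs over \<open>int\<close>
  because of the signs.\<close>

lemma odd_power_plus_one_factor:
  fixes P :: nat
  assumes "odd P" and "odd j"
  obtains r where "odd r" and "P ^ j + 1 = (P + 1) * r"
proof -
  have "\<exists>r::int. odd r \<and> int P ^ (2 * i + 1) + 1 = (int P + 1) * r" for i
  proof (induction i)
    case 0
    show ?case by (intro exI[of _ 1]) simp
  next
    case (Suc i)
    then obtain r :: int where r: "odd r" "int P ^ (2 * i + 1) + 1 = (int P + 1) * r" by blast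
    have "int P ^ (2 * Suc i + 1) + 1 = int P ^ 2 * (int P ^ (2 * i + 1) + 1) - (int P ^ 2 - 1)"
      by (simp add: algebra_simps power2_eq_square)
    also have "\<dots> = (int P + 1) * (int P ^ 2 * r - (int P - 1))"
      unfolding r(2) by (simp add: algebra_simps power2_eq_square)
    finally show ?case using assms r(1)
      by (intro exI[of _ "int P ^ 2 * r - (int P - 1)"]) simp
  qed
  moreover obtain i where "j = 2 * i + 1" using assms(2) oddE by blast
  ultimately obtain r :: int where r: "odd r" "int P ^ j + 1 = (int P + 1) * r" by blast
  have "int P ^ j + 1 > 0" by (simp add: add_nonneg_pos)
  then have "r > 0" unfolding r(2) by (simp add: zero_less_mult_iff)
  then have "int (P ^ j + 1) = int ((P + 1) * nat r)" using r(2) by (simp add: algebra_simps)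
  then have "P ^ j + 1 = (P + 1) * nat r" by (simp only: of_nat_eq_iff)
  moreover have "odd (nat r)" using r(1) \<open>r > 0\<close> by (simp add: even_nat_iff)
  ultimately show thesis using that by blast
qed

section \<open>The order of \<open>P\<close> modulo divisors of \<open>P ^ j + 1\<close>\<close>

lemma cong_power_double_of_dvd:
  fixes P e j :: nat
  assumes "e dvd P ^ j + 1"
  shows "[P ^ (2 * j) = 1] (mod e)"
proof -
  have "int e dvd int (P ^ j + 1) * (int P ^ j - 1)" using assms by (intro dvd_mult2) presburger
  also have "\<dots> = int P ^ (2 * j) - 1" by (simp add: mult_2 power_add left_diff_distrib right_diff_distrib distrib_right)
  finally have "[int (P ^ (2 * j)) = int 1] (mod int e)" by (simp add: cong_iff_dvd_diff)
  then show ?thesis by (simp only: cong_int_iff)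
qed

lemma cong_power_parity:
  fixes P e j :: nat
  assumes "[P\<^sup>2 = 1] (mod e)"
  shows "even j \<Longrightarrow> [P ^ j = 1] (mod e)" and "odd j \<Longrightarrow> [P ^ j = P] (mod e)"
proof -
  have *: "[P ^ (2 * i) = 1] (mod e)" for i
    using cong_pow[OF assms, of i] by (simp add: power_mult)
  then show "even j \<Longrightarrow> [P ^ j = 1] (mod e)" by (elim evenE) simp
  show "odd j \<Longrightarrow> [P ^ j = P] (mod e)"
    using cong_mult[OF * cong_refl[of P e]] by (elim oddE) (simp add: mult.commute)
qed

lemma dvd_two_or_plus_one:
  fixes P e j :: nat
  assumes "[P\<^sup>2 = 1] (mod e)" and "e dvd P ^ j + 1"
  shows "even j \<Longrightarrow> e dvd 2" and "odd j \<Longrightarrow> e dvd P + 1"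
  using cong_add[OF cong_power_parity(1)[OF assms(1), of j] cong_refl[of 1]]
    cong_add[OF cong_power_parity(2)[OF assms(1), of j] cong_refl[of 1]] assms(2)
  by (auto simp: cong_dvd_iff numeral_2_eq_2)

text \<open>The order of \<open>P\<close> modulo \<open>e\<close> divides
  \<open>gcd (2 * j) i = gcd 2 i\<close>, so \<open>P\<^sup>2\<close> is 1 modulo \<open>e\<close>
  and \<open>P ^ j\<close> reduces to 1 or \<open>P\<close>. For odd \<open>i\<close> the order is
  1, leaving \<open>P ^ j + 1\<close> congruent to 2.\<close>

lemma dvd_plus_minus_one:
  fixes P e j i :: nat
  assumes "e dvd P ^ j + 1" and "[P ^ i = 1] (mod e)" and "coprime j i"
  shows "odd i \<or> even j \<Longrightarrow> e dvd 2" and "e dvd 2 \<or> e dvd P + 1"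
proof -
  have "ord e P dvd gcd (2 * j) i"
    using cong_power_double_of_dvd[OF assms(1)] assms(2) ord_divides by auto
  also have "gcd (2 * j) i = gcd 2 i"
    using assms(3) by (simp add: gcd_mult_left_right_cancel coprime_commute)
  finally have o: "ord e P dvd gcd 2 i" .
  then have "ord e P dvd 2" by simp
  then have sq: "[P\<^sup>2 = 1] (mod e)" using ord_divides by blast
  show "e dvd 2 \<or> e dvd P + 1" using dvd_two_or_plus_one[OF sq assms(1)] by auto
  show "e dvd 2" if "odd i \<or> even j"
  proof (cases "even j")
    case True
    then show ?thesis using dvd_two_or_plus_one[OF sq assms(1)] by simp
  next
    case False
    with that have "gcd 2 i = 1" by (simp add: prime_imp_coprime)
    with o have "ord e P dvd 1" by simp
    then have "[P ^ 1 = 1] (mod e)" using ord_divides by blast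
    then have "[P ^ j + 1 = 1 ^ j + 1] (mod e)" by (intro cong_add cong_pow) auto
    then show ?thesis using assms(1) by (simp add: cong_dvd_iff numeral_2_eq_2)
  qed
qed

text \<open>Modulo either gcd the order of \<open>P\<close> divides 2, so each gcd divides 2 or
  \<open>P + 1\<close>. The parity of \<open>d\<close>, or of its cofactor over
  \<open>(P + 1) div 2\<close>, removes the spare factor 2.\<close>

lemma max_gcd_half_power:
  fixes P j i :: nat
  assumes "odd P" and "P > 1" and "j > 0" and "i > 0" and "coprime j i"
  defines "d \<equiv> (P ^ j + 1) div 2"
  shows "max (gcd d (P ^ i - 1)) (gcd d (P ^ i + 1)) = (if even j then 1 else (P + 1) div 2)"
proof -
  define m where "m = gcd d (P ^ i - 1)"
  define l where "l = gcd d (P ^ i + 1)"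
  have d2: "2 * d = P ^ j + 1" using assms(1) unfolding d_def by (simp add: odd_Suc_div_two)
  have P3: "P \<ge> 3" using assms(1,2) by (cases "P = 2") auto
  have md: "m dvd P ^ j + 1" unfolding d2[symmetric] m_def by (simp add: dvd_mult)
  have ld: "l dvd P ^ j + 1" unfolding d2[symmetric] l_def by (simp add: dvd_mult)
  have "m dvd P ^ i - 1" unfolding m_def by simp
  moreover have "P ^ i \<ge> 1" using assms by simp
  ultimately have mc: "[P ^ i = 1] (mod m)" by (simp add: cong_altdef_nat)
  have li: "l dvd P ^ i + 1" unfolding l_def by simp
  have lsq: "[P\<^sup>2 = 1] (mod l)"
  proof -
    have "ord l P dvd gcd (2 * j) (2 * i)"
      using cong_power_double_of_dvd[OF ld] cong_power_double_of_dvd[OF li] ord_divides by auto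
    also have "gcd (2 * j) (2 * i) = 2" using assms(5) by (simp add: gcd_mult_left)
    finally show ?thesis using ord_divides by blast
  qed
  note mm = dvd_plus_minus_one[OF md mc assms(5)]
  note lj = dvd_two_or_plus_one[OF lsq ld] and ln = dvd_two_or_plus_one[OF lsq li]
  show ?thesis
  proof (cases "even j")
    case True
    \<comment> \<open>For even \<open>j\<close>, \<open>P ^ j\<close> is an odd square, hence 1
      modulo 4.\<close>
    have "odd d"
    proof -
      obtain h where h: "j = 2 * h" using True by blast
      obtain t where t: "P ^ h = 2 * t + 1" using assms(1) by (metis oddE even_power)
      have "P ^ j = (2 * t + 1)\<^sup>2" by (metis h t mult.commute power_mult)
      also have "\<dots> = 2 * (2 * (t * t + t)) + 1" by (simp add: power2_eq_square algebra_simps)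
      finally have "d = 2 * (t * t + t) + 1" using d2 by simp
      then show ?thesis by simp
    qed
    moreover have "m dvd d" "l dvd d" by (simp_all add: m_def l_def)
    ultimately have "odd m" "odd l" by (auto dest: dvd_trans)
    moreover have "m dvd 2" "l dvd 2" using mm lj True by simp_all
    ultimately have "m = 1" "l = 1"
      by (metis dvd_refl prime_nat_iff two_is_prime_nat)+
    then show ?thesis using True by (simp add: m_def l_def)
  next
    case False
    define h where "h = (P + 1) div 2"
    have h2: "P + 1 = 2 * h" and h: "h \<ge> 2" using assms(1) P3 by (auto simp: h_def)
    obtain r where r: "odd r" "P ^ j + 1 = (P + 1) * r"
      using odd_power_plus_one_factor[OF assms(1) False] by blast
    have "2 * d = 2 * (h * r)" using d2 r(2) unfolding h2 by simp
    then have d: "d = h * r" by simp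
    \<comment> \<open>Since \<open>d = h * r\<close> with \<open>r\<close> odd and
      \<open>P + 1 = 2 * h\<close>, the gcd of \<open>d\<close> and \<open>P + 1\<close> is exactly
      \<open>h\<close>.\<close>
    have *: "e dvd h" if "e dvd d" "e dvd P + 1" for e
    proof -
      have "e dvd gcd (h * r) (h * 2)" using that d h2 by (simp add: mult.commute)
      also have "\<dots> = h * gcd r 2" by (rule gcd_mult_distrib_nat[symmetric])
      also have "gcd r 2 = 1" using r(1) by (simp add: prime_imp_coprime gcd.commute)
      finally show ?thesis by simp
    qed
    have small: "e \<le> h" if "e dvd d" "e dvd 2 \<or> e dvd P + 1" for e
      using that *[of e] h dvd_imp_le[of e h] dvd_imp_le[of e 2] by linarith
    have "m \<le> h" using small[of m] mm by (simp add: m_def)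
    moreover have "l \<le> h" using small[of l] lj False by (simp add: l_def)
    \<comment> \<open>The parity of \<open>i\<close> decides which gcd reaches \<open>h\<close>:
      \<open>P + 1\<close> divides \<open>P ^ i + 1\<close> for odd \<open>i\<close>, and
      \<open>P\<^sup>2\<close> is 1 modulo \<open>h\<close>, which settles even
      \<open>i\<close>.\<close>
    moreover have "h \<le> m \<or> h \<le> l"
    proof -
      have hd: "h dvd d" and hP: "h dvd P + 1" using d h2 by auto
      show ?thesis
      proof (cases "even i")
        case True
        have "[P ^ (2 * 1) = 1] (mod h)" by (rule cong_power_double_of_dvd) (use hP in simp)
        then have "[P ^ i = 1] (mod h)" using cong_power_parity(1) True by simp
        then have "h dvd P ^ i - 1" using assms by (simp add: cong_altdef_nat)
        then have "h dvd m" using hd by (simp add: m_def)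
        moreover have "d > 0" using d h r(1) by (auto intro!: Nat.gr0I)
        ultimately show ?thesis by (simp add: dvd_imp_le m_def)
      next
        case False
        obtain s where "P ^ i + 1 = (P + 1) * s"
          using odd_power_plus_one_factor[OF assms(1) False] by blast
        then have "h dvd P ^ i + 1" using hP by (metis dvd_mult2)
        then have "h dvd l" using hd by (simp add: l_def)
        then show ?thesis by (simp add: dvd_imp_le l_def)
      qed
    qed
    ultimately have "max m l = h" by linarith
    then show ?thesis using False by (simp add: m_def l_def h_def)
  qed
qed

text \<open>Cancelling \<open>g\<close> leaves \<open>2 * i div gcd 2 j\<close>. This is
  \<open>2 * i\<close> for odd \<open>j\<close>, and \<open>i\<close> for even \<open>j\<close>,
  where coprimality makes \<open>i\<close> odd.\<close>

lemma odd_div_gcd_iff: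
  fixes g j i :: nat
  assumes "g > 0" and "i > 0" and "coprime j i"
  shows "odd (2 * (g * i) div gcd (2 * (g * i)) (g * j)) \<longleftrightarrow> even j"
proof -
  have "gcd (2 * (g * i)) (g * j) = g * gcd (2 * i) j"
    unfolding mult.left_commute[of 2 g i] by (rule gcd_mult_distrib_nat[symmetric])
  also have "gcd (2 * i) j = gcd 2 j"
    using assms(3) by (simp add: gcd_mult_left_right_cancel)
  finally have "2 * (g * i) div gcd (2 * (g * i)) (g * j) = 2 * i div gcd 2 j"
    using assms(1) by (simp add: mult.left_commute)
  moreover have "odd i" if "even j" using that assms(3) coprime_common_divisor_nat[of j i 2] by auto
  moreover have "gcd 2 j = (if even j then 2 else 1)"
    by (auto simp: prime_imp_coprime gcd_proj1_iff)
  ultimately show ?thesis by auto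
qed

section \<open>Roots of unity and finite fields\<close>

lemma field_power_CARD:
  fixes x :: "'a::{field,finite}"
  shows "x ^ CARD('a) = x"
proof (cases "x = 0")
  case False
  have "bij_betw ((*) x) (UNIV - {0}) (UNIV - {0})"
    by (rule bij_betw_byWitness[where f' = "\<lambda>y. y / x"]) (use False in auto)
  from prod.reindex_bij_betw[OF this, of id]
  have "x ^ card (UNIV - {0 :: 'a}) * \<Prod>(UNIV - {0 :: 'a}) = \<Prod>(UNIV - {0 :: 'a})"
    by (simp add: prod.distrib)
  then have "x ^ card (UNIV - {0 :: 'a}) = 1" by simp
  moreover have "CARD('a) = Suc (card (UNIV - {0 :: 'a}))"
    by (rule card.remove) auto
  ultimately show ?thesis by (simp only: power_Suc mult_1_right)
qed (simp add: finite_UNIV_card_ge_0)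

lemma CHAR_of_prime_power_CARD:
  assumes "prime p" and "CARD('a::{field,finite}) = p ^ n"
  shows "CHAR('a) = p"
proof -
  have "prime CHAR('a)" by (rule prime_CHAR_semidom) (simp add: finite_imp_CHAR_pos)
  moreover have "CHAR('a) dvd p ^ n" using CHAR_dvd_CARD[where 'a = 'a] assms(2) by simp
  ultimately show ?thesis using assms(1) by (metis prime_dvd_power primes_dvd_imp_eq)
qed

lemma card_nth_roots_bound:
  fixes c :: "'b::field"
  assumes "N > 0"
  shows "finite {x :: 'b. x ^ N = c}" and "card {x :: 'b. x ^ N = c} \<le> N"
proof -
  define f :: "'b poly" where "f = monom 1 N + [:- c:]"
  have deg: "degree f = N"
    unfolding f_def using assms by (subst degree_add_eq_left) (auto simp: degree_monom_eq)
  then have "f \<noteq> 0" using assms by auto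
  moreover have "{x. poly f x = 0} = {x. x ^ N = c}" by (auto simp: f_def poly_monom)
  ultimately show "finite {x. x ^ N = c}" "card {x. x ^ N = c} \<le> N"
    using poly_roots_finite[of f] card_poly_roots_bound[of f] deg by auto
qed

text \<open>The quotient of two solutions is killed by the exponents \<open>N\<close> and
  \<open>d\<close>, hence by their gcd (Bezout). Dividing by one solution thus embeds the set into
  the roots of unity of order dividing \<open>gcd d N\<close>.\<close>

lemma card_common_roots_bound:
  fixes w :: "'b::field"
  assumes "N > 0" and "d > 0" and "w \<noteq> 0"
  shows "card {v :: 'b. v ^ N = 1 \<and> v ^ d = w} \<le> gcd d N"
proof (cases "{v :: 'b. v ^ N = 1 \<and> v ^ d = w} = {}")
  case False
  then obtain u where u: "u ^ N = 1" "u ^ d = w" by blast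
  with assms have u0: "u \<noteq> 0" by (auto simp: power_0_left)
  obtain r s where rs: "d * r = N * s + gcd d N" using bezout_nat[of d N] assms(2) by auto
  have "(v / u) ^ gcd d N = 1" if "v ^ N = 1" "v ^ d = w" for v
  proof -
    have 1: "(v / u) ^ N = 1" "(v / u) ^ d = 1" using that u assms(3) by (simp_all add: power_divide)
    have "(v / u) ^ (d * r) = (v / u) ^ (N * s) * (v / u) ^ gcd d N" by (simp add: rs power_add)
    then show ?thesis by (simp only: power_mult 1 power_one mult_1)
  qed
  then have "card {v. v ^ N = 1 \<and> v ^ d = w} \<le> card {x :: 'b. x ^ gcd d N = 1}"
    by (intro card_inj_on_le[where f = "\<lambda>v. v / u"] card_nth_roots_bound)
      (use u0 assms in \<open>auto simp: inj_on_def\<close>)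
  also have "\<dots> \<le> gcd d N" by (rule card_nth_roots_bound) (use assms in simp)
  finally show ?thesis .
next
  case True
  then show ?thesis by (simp only: card.empty)
qed

text \<open>Induction splits off a linear factor: the derivative condition keeps the removed root
  from recurring in the cofactor and passes to the cofactor itself.\<close>

lemma card_roots_of_separable:
  fixes f :: "'b::alg_closed_field poly"
  assumes "f \<noteq> 0" and "\<And>x. poly f x = 0 \<Longrightarrow> poly (pderiv f) x \<noteq> 0"
  shows "card {x. poly f x = 0} = degree f"
  using assms
proof (induction "degree f" arbitrary: f)
  case 0
  then obtain c where "f = [:c:]" "c \<noteq> 0" by (metis degree_0_id degree_pCons_0 degree_eq_zeroE pCons_0_0)
  then show ?case by simp
next
  case (Suc n)
  then obtain a where a: "poly f a = 0" using alg_closed_imp_poly_has_root[of f] by auto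
  then obtain h where h: "f = [:-a, 1:] * h" by (auto simp: poly_eq_0_iff_dvd)
  with Suc.prems(1) have h0: "h \<noteq> 0" by auto
  have df: "pderiv f = [:-a, 1:] * pderiv h + h" unfolding h by (simp only: pderiv_mult) (simp add: pderiv_pCons)
  have ha: "poly h a \<noteq> 0" using Suc.prems(2)[OF a] df by simp
  have "degree f = Suc (degree h)" unfolding h using h0 by (subst degree_mult_eq) auto
  with Suc.hyps(2) have dh: "n = degree h" by simp
  have "poly (pderiv h) x \<noteq> 0" if "poly h x = 0" for x
    using Suc.prems(2)[of x] that df h by auto
  with Suc.hyps(1)[OF dh h0] have "card {x. poly h x = 0} = degree h" by blast
  moreover have "{x. poly f x = 0} = insert a {x. poly h x = 0}" by (auto simp: h)
  ultimately show ?case using ha h0 Suc.hyps(2) dh by (simp add: poly_roots_finite)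
qed

text \<open>The derivative of \<open>X ^ N - 1\<close> vanishes at most at 0, which is not a
  root.\<close>

lemma card_roots_of_unity_alg_closed:
  assumes "of_nat N \<noteq> (0 :: 'b::alg_closed_field)"
  shows "card {x :: 'b. x ^ N = 1} = N"
proof -
  define f :: "'b poly" where "f = monom 1 N + [:- 1:]"
  have N: "N > 0" using assms by (auto intro!: Nat.gr0I)
  have deg: "degree f = N"
    unfolding f_def using N by (subst degree_add_eq_left) (auto simp: degree_monom_eq)
  have "pderiv f = monom (of_nat N) (N - 1)" by (simp add: f_def pderiv_add pderiv_pCons pderiv_monom)
  moreover have roots: "poly f x = 0 \<longleftrightarrow> x ^ N = 1" for x by (simp add: f_def poly_monom)
  ultimately have "poly f x = 0 \<Longrightarrow> poly (pderiv f) x \<noteq> 0" for x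
    using assms N by (auto simp: poly_monom power_0_left)
  moreover have "f \<noteq> 0" using deg N by auto
  ultimately show ?thesis using card_roots_of_separable[of f] deg roots by simp
qed

section \<open>The substitution \<open>v + inverse v\<close> and the Frobenius map\<close>

lemma add_inverse_eq_iff:
  fixes u v :: "'b::field"
  assumes "u \<noteq> 0" and "v \<noteq> 0"
  shows "u + inverse u = v + inverse v \<longleftrightarrow> u = v \<or> u = inverse v"
proof -
  have "(u - v) * (u - inverse v) = u * (u + inverse u - (v + inverse v))"
    using assms by (simp add: field_simps)
  then show ?thesis using assms by (metis eq_iff_diff_eq_0 mult_eq_0_iff)
qed

lemma half_power_sum_eq:
  fixes v :: "'b::alg_closed_field" and k :: nat
  assumes "prime CHAR('b)" and "odd CHAR('b)" and "v \<noteq> 0"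
  defines "d \<equiv> (CHAR('b) ^ k + 1) div 2"
  defines "x \<equiv> (v + inverse v - 2) / 4"
  shows "2 * ((x + 1) ^ d + x ^ d) = v ^ d + inverse v ^ d"
proof -
  define Q where "Q = CHAR('b) ^ k"
  have Q: "odd Q" "Q + 1 = 2 * d" using assms(2) by (auto simp: Q_def d_def)
  have two: "(2 :: 'b) \<noteq> 0"
    using assms(1,2) of_nat_eq_0_iff_char_dvd[where 'a = 'b, of 2]
    by (metis dvd_refl of_nat_numeral primes_dvd_imp_eq two_is_prime_nat)
  have four: "(4 :: 'b) \<noteq> 0" using two by (metis mult_2 no_zero_divisors numeral_Bit0 numeral_plus_numeral mult_numeral_1 numeral_times_numeral)
  obtain z where z: "z\<^sup>2 = v" using nth_root_exists[of 2 v] by auto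
  define y where "y = inverse z"
  have zy: "z * y = 1" "y\<^sup>2 = inverse v" using z assms(3) by (auto simp: y_def power_inverse)
  have fd: "(a + b) ^ Q = a ^ Q + b ^ Q" for a b :: 'b
    by (rule freshmans_dream'[OF assms(1)]) (simp add: Q_def)
  have fd': "(a - b) ^ Q = a ^ Q - b ^ Q" for a b :: 'b
    using fd[of a "- b"] Q(1) by simp
  have x4: "4 * x = v + inverse v - 2"
    by (simp only: x_def times_divide_eq_right nonzero_mult_div_cancel_left[OF four])
  have "(z + y)\<^sup>2 = 4 * (x + 1)" "(z - y)\<^sup>2 = 4 * x"
    using zy z by (simp_all add: x4 distrib_left power2_sum power2_diff mult.assoc)
  then have "4 ^ d * (x + 1) ^ d = (z + y) ^ (Q + 1)" "4 ^ d * x ^ d = (z - y) ^ (Q + 1)"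
    unfolding Q(2) power_mult by (simp_all only: power_mult_distrib)
  then have "4 ^ d * ((x + 1) ^ d + x ^ d) = (z + y) ^ (Q + 1) + (z - y) ^ (Q + 1)"
    by (simp add: distrib_left)
  \<comment> \<open>Frobenius gives \<open>(z + y) * (z ^ Q + y ^ Q)\<close> and
    \<open>(z - y) * (z ^ Q - y ^ Q)\<close>; the mixed terms cancel in the sum.\<close>
  also have "\<dots> = 2 * (z ^ (Q + 1) + y ^ (Q + 1))"
    by (simp add: fd fd' algebra_simps)
  also have "\<dots> = 2 * (v ^ d + inverse v ^ d)"
    unfolding Q(2) by (simp add: power_mult z zy)
  also have "(4 :: 'b) ^ d = 2 ^ (Q + 1)" unfolding Q(2) by (simp add: power_mult)
  \<comment> \<open>Frobenius fixes 2, so \<open>4 ^ d\<close> is just 4.\<close>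
  also have "(2 :: 'b) ^ (Q + 1) = 2 * 2" using fd[of 1 1] by simp
  finally show ?thesis by (simp only: mult.assoc mult_left_cancel[OF two])
qed

text \<open>Take \<open>v\<close> as a root of \<open>X\<^sup>2 - y * X + 1\<close>. Frobenius fixes
  \<open>y\<close> and so permutes the roots \<open>v\<close> and \<open>inverse v\<close>; fixing
  \<open>v\<close> gives the exponent \<open>q - 1\<close>, swapping gives
  \<open>q + 1\<close>.\<close>

lemma frobenius_fixed_add_inverse:
  fixes y :: "'b::alg_closed_field"
  assumes "prime CHAR('b)" and "q = CHAR('b) ^ n" and "y ^ q = y"
  obtains v where "v \<noteq> 0" and "y = v + inverse v" and "v ^ (q - 1) = 1 \<or> v ^ (q + 1) = 1"
proof -
  obtain v where v: "poly [:1, - y, 1:] v = 0"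
    using alg_closed_imp_poly_has_root[of "[:1, - y, 1:]"] by auto
  then have v0: "v \<noteq> 0" by auto
  have vy: "y = v + inverse v" using v v0 by (simp add: field_simps)
  have "v ^ q + inverse (v ^ q) = v + inverse v"
    using assms(3) freshmans_dream'[OF assms(1,2), of v "inverse v"] unfolding vy by (simp add: power_inverse)
  then have "v ^ q = v \<or> v ^ q = inverse v" using v0 by (simp add: add_inverse_eq_iff)
  moreover have "v ^ q = v * v ^ (q - 1)" using assms(1,2) by (metis not_prime_0 power_eq_0_iff power_minus_mult mult.commute gr0I)
  ultimately have "v ^ (q - 1) = 1 \<or> v ^ (q + 1) = 1" using v0 by auto
  with that v0 vy show thesis by blast
qed

lemma frobenius_fixed_of_root_of_unity:
  fixes v :: "'b::field"
  assumes "prime CHAR('b)" and "q = CHAR('b) ^ n" and "v ^ (q + 1) = 1"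
  shows "(v + inverse v) ^ q = v + inverse v"
proof -
  have "v ^ q = inverse v" using assms(3) by (simp add: inverse_unique)
  then show ?thesis by (simp add: freshmans_dream'[OF assms(1,2)] power_inverse)
qed

text \<open>The embedded field consists of roots of \<open>X ^ q - X\<close>, with \<open>q\<close>
  its cardinality, and this polynomial has at most \<open>q\<close> roots.\<close>

lemma range_to_ac_eq:
  "range (to_ac :: 'a::{field,finite} \<Rightarrow> _) = {x. x ^ CARD('a) = x}"
proof (rule card_seteq)
  let ?q = "CARD('a)"
  have "card {0 :: 'a, 1} \<le> ?q" by (rule card_mono) auto
  then have q: "?q \<ge> 2" by simp
  define f :: "'a alg_closure poly" where "f = monom 1 ?q + monom (- 1) 1"
  have deg: "degree f = ?q"
    unfolding f_def using q by (subst degree_add_eq_left) (auto simp: degree_monom_eq)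
  then have "f \<noteq> 0" using q by auto
  moreover have "{x. poly f x = 0} = {x. x ^ ?q = x}" by (auto simp: f_def poly_monom)
  ultimately show "finite {x :: 'a alg_closure. x ^ ?q = x}"
    and "card {x :: 'a alg_closure. x ^ ?q = x} \<le> card (range (to_ac :: 'a \<Rightarrow> _))"
    using poly_roots_finite[of f] card_poly_roots_bound[of f] deg
    by (auto simp: card_image inj_to_ac)
qed (auto simp: field_power_CARD simp flip: to_ac_power)

section \<open>Fibres of Dickson polynomials and the uniformity\<close>

lemma sum_card_fibres_le:
  assumes "finite T" and "finite Y"
  shows "(\<Sum>y\<in>Y. card {v \<in> T. f v = y}) \<le> card T"
proof -
  have "(\<Sum>y\<in>Y. card {v \<in> T. f v = y}) = card (\<Union>y\<in>Y. {v \<in> T. f v = y})"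
    using assms by (intro card_UN_disjoint[symmetric]) auto
  also have "\<dots> \<le> card T" using assms by (intro card_mono) auto
  finally show ?thesis .
qed

text \<open>
  Each \<open>y\<close> is hit twice by \<open>v + inverse v\<close> when the two groups of roots of unity are counted
  separately (\<open>\<plusminus>1\<close> lies in both); and \<open>v ^ d\<close> is determined up to inversion. If it is not its own
  inverse, only one of the two groups can contribute.
\<close>
lemma card_dickson_fibre_le:
  fixes \<beta> :: "'b::alg_closed_field"
  assumes "prime CHAR('b)" and "odd CHAR('b)" and "q = CHAR('b) ^ n" and "n > 0" and "d > 0"
  defines "Y \<equiv> {y. y ^ q = y \<and> (\<exists>v. v \<noteq> 0 \<and> y = v + inverse v \<and> v ^ d + inverse v ^ d = \<beta>)}"
  shows "card Y \<le> max (gcd d (q - 1)) (gcd d (q + 1))"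
\<comment> \<open>If \<open>Y\<close> is empty or infinite, \<open>card Y\<close> is 0 and the bound
  is trivial.\<close>
proof (cases "finite Y \<and> Y \<noteq> {}")
  case True
  then obtain v0 where v0: "v0 \<noteq> 0" "v0 ^ d + inverse v0 ^ d = \<beta>" by (auto simp: Y_def)
  define w where "w = v0 ^ d"
  have w0: "w \<noteq> 0" and wb: "w + inverse w = \<beta>" using v0 by (auto simp: w_def power_inverse)
  have "odd q" using assms(2,3) by simp
  moreover have "q > 1" unfolding assms(3) by (rule one_less_power[OF prime_gt_1_nat[OF assms(1)] assms(4)])
  ultimately have q: "q - 1 > 0" "q + 1 > 0" "even (q - 1)" "even (q + 1)" by auto
  define S where "S N c = {v :: 'b. v ^ N = 1 \<and> v ^ d = c}" for N c
  \<comment> \<open>The \<open>v\<close> in the group of exponent \<open>N\<close> with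
    \<open>v ^ d + inverse v ^ d = \<beta>\<close>, since this equation determines
    \<open>v ^ d\<close> up to inversion.\<close>
  define T where "T N = S N w \<union> S N (inverse w)" for N
  have finS: "finite (S N c)" and cardS: "c \<noteq> 0 \<Longrightarrow> card (S N c) \<le> gcd d N" if "N > 0" for N c
    using card_common_roots_bound[OF that assms(5), of c] card_nth_roots_bound(1)[OF that, of "1 :: 'b"]
    by (auto simp: S_def)
  have two_le: "2 \<le> card {v \<in> T (q - 1). v + inverse v = y} + card {v \<in> T (q + 1). v + inverse v = y}"
    if y: "y \<in> Y" for y
  proof -
    have "y ^ q = y" using y by (simp add: Y_def)
    then obtain v where v: "v \<noteq> 0" "y = v + inverse v" "v ^ (q - 1) = 1 \<or> v ^ (q + 1) = 1"
      using frobenius_fixed_add_inverse[OF assms(1,3)] by blast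
    obtain u where u: "u \<noteq> 0" "y = u + inverse u" "u ^ d + inverse u ^ d = \<beta>" using y by (auto simp: Y_def)
    have "u = v \<or> u = inverse v" using u(1,2) v(1,2) by (metis add_inverse_eq_iff)
    then have "v ^ d + inverse (v ^ d) = w + inverse w" using u(3) wb by (auto simp: power_inverse add.commute)
    then have vd: "v ^ d = w \<or> v ^ d = inverse w" using v(1) w0 by (simp add: add_inverse_eq_iff)
    have sub: "{v, inverse v} \<subseteq> {v \<in> T N. v + inverse v = y}" if "v ^ N = 1" for N
      using that vd v(1,2) by (auto simp: T_def S_def power_inverse add.commute)
    have le: "card {v, inverse v} \<le> card {v \<in> T N. v + inverse v = y}" if "v ^ N = 1" "N > 0" for N
      by (intro card_mono sub) (use that finS in \<open>auto simp: T_def\<close>)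
    show ?thesis
    proof (cases "v = inverse v")
      case False
      then show ?thesis using v(3) le[OF _ q(1)] le[OF _ q(2)] by auto
    next
      case True
      \<comment> \<open>Both \<open>q - 1\<close> and \<open>q + 1\<close> are even, so such a
        \<open>v\<close> contributes one element to each count.\<close>
      then have "v\<^sup>2 = 1" using v(1) by (metis power2_eq_square right_inverse)
      then have one: "v ^ N = 1" if "even N" for N using that by (elim evenE) (simp add: power_mult)
      note le[OF one[OF q(3)] q(1)] le[OF one[OF q(4)] q(2)]
      moreover have "card {v, inverse v} \<ge> 1" using card_gt_0_iff[of "{v, inverse v}"] by simp
      ultimately show ?thesis by linarith
    qed
  qed
  have finT: "finite (T (q - 1))" "finite (T (q + 1))" using finS q by (auto simp: T_def)
  have "2 * card Y = (\<Sum>y\<in>Y. 2)" by simp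
  also have "\<dots> \<le> (\<Sum>y\<in>Y. card {v \<in> T (q - 1). v + inverse v = y} + card {v \<in> T (q + 1). v + inverse v = y})"
    by (intro sum_mono two_le)
  also have "\<dots> \<le> card (T (q - 1)) + card (T (q + 1))"
    unfolding sum.distrib using True finT by (intro add_mono sum_card_fibres_le) auto
  finally have Y: "2 * card Y \<le> card (T (q - 1)) + card (T (q + 1))" .
  show ?thesis
  proof (cases "w = inverse w")
    case True
    \<comment> \<open>Here \<open>T N\<close> is the single set \<open>S N w\<close>, so
      \<open>2 * card Y\<close> is at most the sum of the two gcds, hence at most twice their
      maximum.\<close>
    then have "card (T N) \<le> gcd d N" if "N > 0" for N using cardS[OF that w0] by (simp add: T_def)
    from this[OF q(1)] this[OF q(2)] Y show ?thesis by linarith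
  next
    case False
    have le: "card (T N) \<le> 2 * gcd d N" if "N > 0" for N
      using cardS[OF that, of w] cardS[OF that, of "inverse w"] w0 card_Un_le[of "S N w" "S N (inverse w)"]
      by (simp add: T_def)
    have *: "w ^ N = 1" if N: "T N \<noteq> {}" for N
    proof -
      obtain v where "v ^ N = 1" "v ^ d = w \<or> inverse (v ^ d) = w"
        using N by (auto simp: T_def S_def)
      moreover have "(v ^ d) ^ N = (v ^ N) ^ d" for v :: 'b by (simp add: mult.commute flip: power_mult)
      ultimately show ?thesis by (auto simp: power_inverse)
    qed
    \<comment> \<open>If both groups contributed, \<open>w\<close> would lie in both, which forces
      \<open>w\<^sup>2 = 1\<close>.\<close>
    have "T (q - 1) = {} \<or> T (q + 1) = {}"
    proof (rule ccontr)
      assume "\<not> ?thesis"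
      then have "w ^ (q - 1) = 1" "w ^ (q + 1) = 1" using *[of "q - 1"] *[of "q + 1"] by blast+
      moreover have "w ^ (q + 1) = w ^ (q - 1) * w\<^sup>2" using q(1) by (simp flip: power_add)
      ultimately have "w * w = 1" by (simp add: power2_eq_square)
      then show False using False w0 by (metis inverse_unique)
    qed
    then show ?thesis using Y le[OF q(1)] le[OF q(2)] by auto
  qed
qed auto

section \<open>From fibre counts to the uniformity\<close>

lemma c_diff_uniformity_eqI:
  assumes "\<And>a b. c = 1 \<longrightarrow> a \<noteq> 0 \<Longrightarrow> c_diff_count F c a b \<le> M"
    and "c = 1 \<longrightarrow> a0 \<noteq> 0" and "M \<le> c_diff_count F c a0 b0"
  shows "c_diff_uniformity F c = M"
proof -
  have "c_diff_count F c a0 b0 = M" using assms by (simp add: order_antisym)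
  then show ?thesis
    unfolding c_diff_uniformity_def using assms by (intro Max_eqI) (auto intro: finite_subset[of _ "{..M}"])
qed

lemma c_diff_uniformity_half_power:
  fixes p k n :: nat
  assumes p: "prime p" "odd p" and kn: "k < n" and q: "CARD('a::{field,finite}) = p ^ n"
  defines "d \<equiv> (p ^ k + 1) div 2"
  shows "c_diff_uniformity (\<lambda>x :: 'a. x ^ d) (- 1) = max (gcd d (p ^ n - 1)) (gcd d (p ^ n + 1))"
proof -
  define q where "q = p ^ n"
  define m where "m = gcd d (q - 1)"
  define l where "l = gcd d (q + 1)"
  let ?F = "\<lambda>x :: 'a. x ^ d"
  let ?\<tau> = "to_ac :: 'a \<Rightarrow> 'a alg_closure"
  have CHAR: "CHAR('a) = p" by (rule CHAR_of_prime_power_CARD[OF p(1) q])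
  then have ch: "prime CHAR('a alg_closure)" "odd CHAR('a alg_closure)" "q = CHAR('a alg_closure) ^ n"
    using p by (simp_all add: q_def)
  have p3: "p \<ge> 3" using p prime_ge_2_nat[of p] by (cases "p = 2") auto
  have d2: "2 * d = p ^ k + 1" using p(2) unfolding d_def by simp
  then have d0: "d > 0" by (auto intro!: Nat.gr0I)
  have "p ^ Suc k \<le> p ^ n" using kn p3 by (intro power_increasing) auto
  \<comment> \<open>This yields \<open>2 * d < q + 1\<close>, which later guarantees a root of unity
    \<open>u\<close> with \<open>u ^ d\<close> different from 1 and -1.\<close>
  then have kq: "3 * p ^ k \<le> q" using p3 unfolding q_def by (simp add: order_trans[OF mult_right_mono])
  have "p ^ k > 0" using p3 by simp
  then have q1: "q > 1" and dq: "2 * d < q + 1" using kq d2 by linarith+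
  have two: "(2 :: 'a) \<noteq> 0"
    using of_nat_eq_0_iff_char_dvd[where 'a = 'a, of 2] p3 by (auto simp: CHAR dest: dvd_imp_le)
  have "(4 :: 'a) = 2 * 2" by simp
  then have four: "(4 :: 'a) \<noteq> 0" using two by (metis mult_eq_0_iff)
  have pq: "p dvd q" using kn by (simp add: q_def)
  \<comment> \<open>Divisors of \<open>q - 1\<close> or \<open>q + 1\<close> are prime to
    \<open>p\<close>, so the corresponding roots of unity are all distinct.\<close>
  have root_count: "card {z :: 'a alg_closure. z ^ N = 1} = N" if "N dvd q - 1 \<or> N dvd q + 1" for N
  proof (rule card_roots_of_unity_alg_closed)
    have "\<not> p dvd N"
    proof
      assume "p dvd N"
      with that have "p dvd q - 1 \<or> p dvd q + 1" using dvd_trans by blast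
      then have "p dvd 1" using pq q1 by (metis dvd_add_right_iff dvd_diff_nat dvd_diffD1 less_imp_le)
      then show False using p3 by simp
    qed
    then show "of_nat N \<noteq> (0 :: 'a alg_closure)" by (simp add: of_nat_eq_0_iff_char_dvd CHAR)
  qed
  have range: "range ?\<tau> = {x. x ^ q = x}" using range_to_ac_eq[where 'a = 'a] by (simp add: assms q_def)
  \<comment> \<open>The substitution, pulled back to the ground field; it is applied only where
    \<open>v + inverse v\<close> lies in the range of the embedding.\<close>
  define \<psi> where "\<psi> v = of_ac ((v + inverse v - 2) / 4)" for v :: "'a alg_closure"
  have dickson: "2 * ((?\<tau> x + 1) ^ d + ?\<tau> x ^ d) = v ^ d + inverse v ^ d"
    if "v \<noteq> 0" "4 * ?\<tau> x + 2 = v + inverse v" for x v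
  proof -
    have "?\<tau> 4 \<noteq> 0" unfolding to_ac_eq_0_iff by (rule four)
    then have x: "(v + inverse v - 2) / 4 = ?\<tau> x" by (simp flip: that(2))
    show ?thesis
      using half_power_sum_eq[OF ch(1,2) that(1), of k] unfolding x d_def CHAR_alg_closure CHAR .
  qed

  \<comment> \<open>Upper bound for all shifts\<close>
  have upper: "c_diff_count ?F (- 1) a b \<le> max m l" for a b
  proof (cases "a = 0")
    case True
    have "card {x :: 'a. x ^ d = b / 2} \<le> m"
    proof (cases "b = 0")
      case True
      then have "{x :: 'a. x ^ d = b / 2} = {0}" using d0 by auto
      then show ?thesis using d0 by (simp add: m_def Suc_le_eq)
    next
      case False
      have "x ^ (q - 1) = 1" if "x \<noteq> 0" for x :: 'a
      proof -
        have "x * x ^ (q - 1) = x * 1"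
          using field_power_CARD[of x] q1 by (simp add: assms q_def flip: power_Suc)
        then show ?thesis using that by simp
      qed
      then have "{x :: 'a. x ^ d = b / 2} \<subseteq> {x. x ^ (q - 1) = 1 \<and> x ^ d = b / 2}"
        using False two d0 by (auto simp: power_0_left)
      then have "card {x :: 'a. x ^ d = b / 2} \<le> card {x :: 'a. x ^ (q - 1) = 1 \<and> x ^ d = b / 2}"
        by (intro card_mono) auto
      also have "\<dots> \<le> m" unfolding m_def using False two q1 d0 by (intro card_common_roots_bound) auto
      finally show ?thesis .
    qed
    moreover have "x ^ d + x ^ d = b \<longleftrightarrow> x ^ d = b / 2" for x :: 'a
      using two by (auto simp: field_simps)
    ultimately show ?thesis unfolding c_diff_count_def using True by simp
  next
    case False
    \<comment> \<open>Dividing by \<open>a ^ d\<close> reduces the shift \<open>a\<close> to the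
      shift 1 at \<open>x / a\<close>. The affine map \<open>4 * x + 2\<close> then turns solutions
      into values \<open>v + inverse v\<close>.\<close>
    define Y where "Y = {y :: 'a alg_closure. y ^ q = y \<and>
      (\<exists>v. v \<noteq> 0 \<and> y = v + inverse v \<and> v ^ d + inverse v ^ d = ?\<tau> (2 * b / a ^ d))}"
    have "c_diff_count ?F (- 1) a b \<le> card Y" unfolding c_diff_count_def
    proof (rule card_inj_on_le[where f = "\<lambda>x. 4 * ?\<tau> (x / a) + 2"])
      show "inj_on (\<lambda>x. 4 * ?\<tau> (x / a) + 2) {x. (x + a) ^ d - - 1 * x ^ d = b}"
      proof (rule inj_onI)
        fix x y assume "4 * ?\<tau> (x / a) + 2 = 4 * ?\<tau> (y / a) + 2"
        then have "?\<tau> (4 * (x / a)) = ?\<tau> (4 * (y / a))" by simp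
        then have "4 * (x / a) = 4 * (y / a)" unfolding to_ac_eq_iff .
        then show "x = y" using four False by simp
      qed
      show "(\<lambda>x. 4 * ?\<tau> (x / a) + 2) ` {x. (x + a) ^ d - - 1 * x ^ d = b} \<subseteq> Y"
      proof (rule image_subsetI, unfold mem_Collect_eq)
        fix x assume x: "(x + a) ^ d - - 1 * x ^ d = b"
        have "x + a = a * (x / a + 1)" "x = a * (x / a)" using False by (simp_all add: distrib_left)
        then have "(x + a) ^ d = a ^ d * (x / a + 1) ^ d" "x ^ d = a ^ d * (x / a) ^ d"
          by (metis power_mult_distrib)+
        with x have "a ^ d * ((x / a + 1) ^ d + (x / a) ^ d) = b" by (simp only: distrib_left) simp
        then have b: "(x / a + 1) ^ d + (x / a) ^ d = b / a ^ d"
          using False by (metis nonzero_mult_div_cancel_left power_not_zero)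
        have "4 * ?\<tau> (x / a) + 2 = ?\<tau> (4 * (x / a) + 2)" by simp
        then have y: "(4 * ?\<tau> (x / a) + 2) ^ q = 4 * ?\<tau> (x / a) + 2" using range by blast
        obtain v where v: "v \<noteq> 0" "4 * ?\<tau> (x / a) + 2 = v + inverse v"
          using frobenius_fixed_add_inverse[OF ch(1,3) y] by blast
        have "v ^ d + inverse v ^ d = 2 * ?\<tau> ((x / a + 1) ^ d + (x / a) ^ d)"
          using dickson[OF v] by simp
        also have "\<dots> = ?\<tau> (2 * b / a ^ d)" unfolding b by simp
        finally show "4 * ?\<tau> (x / a) + 2 \<in> Y" using v y unfolding Y_def by blast
      qed
      have "Y \<subseteq> range ?\<tau>" unfolding range by (auto simp: Y_def)
      then show "finite Y" by (rule finite_subset) simp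
    qed
    also have "card Y \<le> max m l"
      unfolding Y_def m_def l_def by (rule card_dickson_fibre_le[OF ch]) (use kn d0 in auto)
    finally show ?thesis .
  qed

  \<comment> \<open>Attaining \<open>m\<close> with the shift 0\<close>
  have m_le: "m \<le> c_diff_count ?F (- 1) 0 2"
  proof -
    \<comment> \<open>As \<open>m\<close> divides \<open>q - 1\<close>, these roots of unity lie in
      the ground field; as \<open>m\<close> divides \<open>d\<close>, they satisfy
      \<open>2 * x ^ d = 2\<close>.\<close>
    have "m = card {z :: 'a alg_closure. z ^ m = 1}" by (rule root_count[symmetric]) (simp add: m_def)
    also have "\<dots> \<le> card (?\<tau> ` {x. x ^ d = 1})"
    proof (rule card_mono, simp, rule subsetI, unfold mem_Collect_eq)
      fix z :: "'a alg_closure" assume z: "z ^ m = 1"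
      have "m dvd q - 1" "m dvd d" by (simp_all add: m_def)
      then have z1: "z ^ (q - 1) = 1" "z ^ d = 1" using z by (auto simp: power_mult elim!: dvdE)
      have "z ^ q = z ^ (q - 1) * z" using q1 by (simp flip: power_Suc2)
      with z1 have "z \<in> range ?\<tau>" unfolding range by simp
      then obtain x where "z = ?\<tau> x" by blast
      with z1 show "z \<in> ?\<tau> ` {x. x ^ d = 1}" by (auto simp flip: to_ac_power)
    qed
    also have "\<dots> = card {x :: 'a. x ^ d = 1}" by (intro card_image inj_on_subset[OF inj_to_ac]) simp
    also have "\<dots> \<le> c_diff_count ?F (- 1) 0 2" unfolding c_diff_count_def by (intro card_mono) auto
    finally show ?thesis .
  qed

  \<comment> \<open>Attaining \<open>l\<close> with the shift 1\<close>
  have l_le: "\<exists>b. l \<le> c_diff_count ?F (- 1) 1 b"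
  proof -
    let ?U = "\<lambda>c. {u :: 'a alg_closure. u ^ (q + 1) = 1 \<and> u ^ d = c}"
    have fin: "finite {u :: 'a alg_closure. u ^ (q + 1) = 1}" by (rule card_nth_roots_bound) simp
    \<comment> \<open>At most \<open>2 * l \<le> 2 * d < q + 1\<close> of the \<open>q + 1\<close>
      roots of unity have \<open>d\<close>-th power 1 or -1, so a suitable \<open>u\<close>
      remains.\<close>
    have "card (?U 1 \<union> ?U (- 1)) \<le> 2 * l"
      using card_Un_le[of "?U 1" "?U (- 1)"] card_common_roots_bound[of "q + 1" d "1 :: 'a alg_closure"]
        card_common_roots_bound[of "q + 1" d "- 1 :: 'a alg_closure"] d0 by (simp add: l_def)
    also have "l \<le> d" using d0 by (simp add: l_def gcd_le1_nat)
    also have "2 * d < q + 1" by (rule dq)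
    also have "\<dots> = card {u :: 'a alg_closure. u ^ (q + 1) = 1}" by (rule root_count[symmetric]) simp
    finally have "\<not> {u :: 'a alg_closure. u ^ (q + 1) = 1} \<subseteq> ?U 1 \<union> ?U (- 1)"
      using fin by (auto dest!: card_mono[rotated])
    then obtain u :: "'a alg_closure" where u: "u ^ (q + 1) = 1" "u ^ d \<noteq> 1" "u ^ d \<noteq> - 1" by blast
    have u0: "u \<noteq> 0" using u(1) by auto
    have ud: "u ^ d \<noteq> inverse (u ^ d)"
    proof
      assume "u ^ d = inverse (u ^ d)"
      then have "(u ^ d)\<^sup>2 = 1" using u0 by (metis power2_eq_square power_not_zero right_inverse)
      then show False using u by (simp add: power2_eq_1_iff)
    qed
    \<comment> \<open>\<open>G\<close> contains the translate by \<open>u\<close> of the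
      \<open>l\<close>-th roots of unity, and all of \<open>G\<close> gives one value of the Dickson
      polynomial.\<close>
    define G where "G = {v :: 'a alg_closure. v ^ (q + 1) = 1 \<and> v ^ d = u ^ d}"
    have "l = card {z :: 'a alg_closure. z ^ l = 1}" by (rule root_count[symmetric]) (simp add: l_def)
    also have "\<dots> \<le> card G"
    proof (rule card_inj_on_le[where f = "\<lambda>z. u * z"])
      have "l dvd q + 1" "l dvd d" by (simp_all add: l_def)
      then have "z ^ (q + 1) = 1" "z ^ d = 1" if "z ^ l = 1" for z :: "'a alg_closure"
        using that by (metis dvdE power_mult power_one)+
      then show "(\<lambda>z. u * z) ` {z. z ^ l = 1} \<subseteq> G"
        by (intro image_subsetI) (simp only: G_def mem_Collect_eq power_mult_distrib u(1) mult_1_right)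
      show "finite G" using fin by (rule rev_finite_subset) (auto simp: G_def)
    qed (use u0 in \<open>auto simp: inj_on_def\<close>)
    finally have lG: "l \<le> card G" .
    have G0: "v \<noteq> 0" if "v \<in> G" for v using that by (auto simp: G_def)
    have \<psi>: "4 * ?\<tau> (\<psi> v) + 2 = v + inverse v" if "v \<in> G" for v
    proof -
      have "v + inverse v \<in> range ?\<tau>"
        unfolding range using frobenius_fixed_of_root_of_unity[OF ch(1,3)] that by (simp add: G_def)
      then obtain t where t: "v + inverse v = ?\<tau> t" by blast
      have "(v + inverse v - 2) / 4 = ?\<tau> ((t - 2) / 4)" by (simp add: t)
      then have "\<psi> v = (t - 2) / 4" by (simp only: \<psi>_def of_ac_to_ac)
      then have "t = 4 * \<psi> v + 2" using four by (simp add: algebra_simps)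
      then show ?thesis by (simp add: t)
    qed
    define b where "b = (\<psi> u + 1) ^ d + \<psi> u ^ d"
    have "card G \<le> c_diff_count ?F (- 1) 1 b"
      unfolding c_diff_count_def
    proof (rule card_inj_on_le[where f = \<psi>])
      show "inj_on \<psi> G"
      proof (rule inj_onI)
        fix v v' assume v: "v \<in> G" "v' \<in> G" "\<psi> v = \<psi> v'"
        then have "v + inverse v = v' + inverse v'" using \<psi> by metis
        then have "v = v' \<or> v = inverse v'" using G0 v by (simp add: add_inverse_eq_iff)
        \<comment> \<open>Otherwise \<open>u ^ d\<close> would be its own inverse; this is why
          \<open>u ^ d\<close> had to avoid 1 and -1.\<close>
        moreover have "v \<noteq> inverse v'" using v ud by (auto simp: G_def power_inverse)
        ultimately show "v = v'" by blast
      qed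
      have val: "?\<tau> (2 * ((\<psi> v + 1) ^ d + \<psi> v ^ d)) = u ^ d + inverse u ^ d" if "v \<in> G" for v
        using dickson[OF G0[OF that] \<psi>[OF that]] that by (simp add: G_def power_inverse)
      have "u \<in> G" using u by (simp add: G_def)
      have "(\<psi> v + 1) ^ d + \<psi> v ^ d = b" if "v \<in> G" for v
      proof -
        have "2 * ((\<psi> v + 1) ^ d + \<psi> v ^ d) = 2 * b"
          using val[OF that] val[OF \<open>u \<in> G\<close>] unfolding b_def by (metis to_ac_eq_iff)
        then show ?thesis using two by (metis mult_left_cancel)
      qed
      then show "\<psi> ` G \<subseteq> {x. (x + 1) ^ d - - 1 * x ^ d = b}" by auto
    qed simp
    with lG show ?thesis using order_trans by blast
  qed

  have "(- 1 :: 'a) \<noteq> 1" using two by (metis add.left_inverse one_add_one)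
  moreover obtain a b where "max m l \<le> c_diff_count ?F (- 1) a b"
    using m_le l_le by (metis max_def)
  ultimately have "c_diff_uniformity ?F (- 1) = max m l"
    using upper by (intro c_diff_uniformity_eqI) auto
  then show ?thesis by (simp add: m_def l_def q_def)
qed

theorem theorem7:
  fixes p k n :: nat
    and F :: "'a::{field,finite} \<Rightarrow> 'a"
  assumes "prime p" and "odd p"
    and "1 \<le> k" and "k < n" and "n \<ge> 3"
    and "card (UNIV :: 'a set) = p ^ n"
    and "F = (\<lambda>x. x ^ ((p ^ k + 1) div 2))"
  shows "(perfect_c_nonlinear F (- 1) \<longleftrightarrow> odd (2 * n div gcd (2 * n) k)) \<and>
    (even (2 * n div gcd (2 * n) k) \<longrightarrow>
      c_diff_uniformity F (- 1) = (p ^ gcd k n + 1) div 2)"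
proof -
  \<comment> \<open>With base \<open>p ^ g\<close>, the exponents \<open>k\<close> and
    \<open>n\<close> become the coprime \<open>j\<close> and \<open>i\<close> required by the gcd
    computation.\<close>
  define g where "g = gcd k n"
  have g: "g > 0" using assms(3) by (simp add: g_def)
  obtain j i where "k = j * g" "n = i * g" and cop: "coprime j i"
    using gcd_coprime_exists[of k n] g unfolding g_def by blast
  then have ji: "k = g * j" "n = g * i" by (simp_all only: mult.commute)
  have pos: "j > 0" "i > 0" using ji assms(3,4) by (auto intro!: Nat.gr0I)
  have p3: "p \<ge> 3" using assms(1,2) prime_ge_2_nat[of p] by (cases "p = 2") auto
  have "p ^ 1 \<le> p ^ g" using p3 g by (intro power_increasing) auto
  then have P: "odd (p ^ g)" "p ^ g \<ge> 3" using p3 assms(2) by auto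
  have pow: "p ^ k = (p ^ g) ^ j" "p ^ n = (p ^ g) ^ i" by (simp_all only: ji(1,2) power_mult)
  have "c_diff_uniformity F (- 1) = (if even j then 1 else (p ^ g + 1) div 2)"
    using max_gcd_half_power[OF P(1) _ pos cop] P(2)
      c_diff_uniformity_half_power[OF assms(1,2,4,6)]
    unfolding assms(7) pow by simp
  moreover have "odd (2 * n div gcd (2 * n) k) \<longleftrightarrow> even j"
    using odd_div_gcd_iff[OF g pos(2) cop] by (simp flip: ji(1,2))
  \<comment> \<open>The second value is at least 2, so uniformity 1 occurs only for even
    \<open>j\<close>.\<close>
  moreover have "(p ^ g + 1) div 2 \<noteq> 1" using P(2) by linarith
  ultimately show ?thesis by (auto simp: perfect_c_nonlinear_def g_def)
qed

end
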